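(* Let $X$ be a finite Ramsey set in a Euclidean space, and let $z$ be a point of a Euclidean space containing $X$ with $z \notin \operatorname{aff}(X)$. Then $X\cup\{z\}$ is Ramsey.
   Context: A Euclidean space is $\mathbb{R}^d$ for some $d$, with its usual Euclidean norm and distance. A finite set $X$ in a Euclidean space is called Ramsey if, for every positive integer $k$, there is an integer $N$ such that every $k$-colouring of $\mathbb{R}^N$ (that is, every function from $\mathbb{R}^N$ to a set of $k$ colours) contains a monochromatic isometric copy of $X$, i.e. there is a distance-preserving map $\varphi: X\to\mathbb{R}^N$ whose image has all its points of the same colour. $\operatorname{aff}(X)$ denotes the affine hull of $X$. *)

theory Defs
  imports "HOL-Analysis.Analysis"
begin

text \<open>
  The dimension \<open>N\<close> of the coloured space is quantified inside the definition of a Ramsey set, so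
  it cannot be a type: \<open>\<real>\<^sup>N\<close> is the library's carrier \<^term>\<open>topspace (Euclidean_space N)\<close>, the set of
  all \<open>x :: nat \<Rightarrow> real\<close> with \<open>x i = 0\<close> for \<open>i \<ge> N\<close>. Only this carrier is used; distances are
  Euclidean and given explicitly by the following function.
\<close>

definition euclidean_dist :: "nat \<Rightarrow> (nat \<Rightarrow> real) \<Rightarrow> (nat \<Rightarrow> real) \<Rightarrow> real" where
  "euclidean_dist N x y = L2_set (\<lambda>i. x i - y i) {..<N}"

definition monochromatic_copy ::
    "'a::euclidean_space set \<Rightarrow> nat \<Rightarrow> ((nat \<Rightarrow> real) \<Rightarrow> nat) \<Rightarrow> ('a \<Rightarrow> nat \<Rightarrow> real) \<Rightarrow> bool" where
  "monochromatic_copy X N c \<phi> \<longleftrightarrow>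
     \<phi> \<in> X \<rightarrow> topspace (Euclidean_space N) \<and>
     (\<forall>x\<in>X. \<forall>y\<in>X. euclidean_dist N (\<phi> x) (\<phi> y) = dist x y) \<and>
     (\<forall>x\<in>X. \<forall>y\<in>X. c (\<phi> x) = c (\<phi> y))"

text \<open>
  A \<open>k\<close>-colouring of \<open>\<real>\<^sup>N\<close> takes its values in \<open>{..<k}\<close>; its values outside the carrier are irrelevant.
\<close>

definition ramsey_set :: "'a::euclidean_space set \<Rightarrow> bool" where
  "ramsey_set X \<longleftrightarrow>
     finite X \<and>
     (\<forall>k\<ge>1. \<exists>N. \<forall>c \<in> topspace (Euclidean_space N) \<rightarrow> {..<k}. \<exists>\<phi>. monochromatic_copy X N c \<phi>)"

end

theory Submission
  imports Defs "HOL-Library.Ramsey"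
begin

text \<open>
  Let \<open>X\<close> be nonempty. Let \<open>p\<close> be the foot of the perpendicular from \<open>z\<close> to the affine hull of \<open>X\<close> and \<open>h > 0\<close> its length.
  A copy of \<open>X\<close> in some space determines the position of every affine combination of \<open>X\<close>, in particular
  of \<open>p\<close>. Colours of these extra points cannot be controlled when the copy is chosen. What can be
  controlled, by the usual product argument, is a product of \<open>n\<close> blocks in which each block holds either a
  point of a copy of \<open>X\<close> or one of finitely many extra points determined by that copy: the
  copies can be chosen such that the colour of such a vector is not affected by moving a block
  inside its copy of \<open>X\<close> (lemma \<open>product_forcing\<close>, whose hypothesis is supplied by the compactness
  lemma \<open>finitely_many_copies_suffice\<close> and the extension lemma \<open>isometric_embedding_extend\<close>).

  The colour then depends only on which blocks hold which extra points. Fix \<open>x\<^sub>0 \<in> X\<close> and cut the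
  segment from \<open>p\<close> to \<open>x\<^sub>0\<close> into \<open>m\<close> equal steps. For an \<open>m\<close>-element set \<open>J\<close> of blocks, put the points
  \<open>p = q\<^sub>0, q\<^sub>1, \<dots>\<close> of the subdivision into the blocks of \<open>J\<close> in increasing order, and \<open>x\<^sub>0 = q\<^sub>m\<close> into all
  other blocks. By Ramsey's theorem there are blocks \<open>j\<^sub>0 < \<dots> < j\<^sub>m\<close> such that \<open>{j\<^sub>1, \<dots>, j\<^sub>m}\<close> and
  \<open>{j\<^sub>0, \<dots>, j\<^bsub>m-1\<^esub>}\<close> get the same colour. In the vector of the first set, the block \<open>j\<^sub>0\<close> can be moved
  through a copy of \<open>X\<close>. In the vector of the second set, the block \<open>j\<^sub>0\<close> holds the point \<open>p\<close> of that copy,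
  and each other block \<open>j\<^sub>r\<close> differs by only one step of the subdivision. So the second vector lies
  over \<open>p\<close> at the squared height \<open>m \<cdot> (|p - x\<^sub>0| / m)\<^sup>2 = |p - x\<^sub>0|\<^sup>2 / m\<close>, and has the colour of
  the copy. With \<open>m\<close> large this is at most \<open>h\<^sup>2\<close>, and letting the path start at a suitable height
  above \<open>p\<close> instead of \<open>p\<close> makes up for the difference (lemma \<open>path_forcing\<close>).
\<close>

section \<open>Consecutive windows of the same colour\<close>

text \<open>
This is what the path argument needs from Ramsey's theorem: two consecutive windows of the same
increasing sequence that receive the same colour. The colouring is one of finite sets, and a
homogeneous set with \<open>m + 1\<close> elements contains both windows.
\<close>

lemma consecutive_sets_same_colour:
  fixes k m :: nat
  shows "\<exists>n::nat. \<forall>f. (\<forall>J. f J < k) \<longrightarrow>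
     (\<exists>h. strict_mono_on {..m} h \<and> h ` {..m} \<subseteq> {..<n} \<and> f (h ` {..<m}) = f (h ` {0<..m}))"
proof -
  obtain n where n: "partn_lst {..<n::nat} (replicate k (Suc m)) m"
    using ramsey_full by blast
  show ?thesis
  proof (intro exI[of _ n] allI impI)
    fix f :: "nat set \<Rightarrow> nat"
    assume "\<forall>J. f J < k"
    then have "f \<in> nsets {..<n} m \<rightarrow> {..<length (replicate k (Suc m))}"
      by simp
    then obtain i H where "i < k" and H: "H \<in> nsets {..<n} (Suc m)"
      and mono: "f ` nsets H m \<subseteq> {i}"
      using n by (fastforce simp: partn_lst_def monochromatic_def)
    have "finite H" "card H = Suc m" "H \<subseteq> {..<n}"
      using H by (auto simp: nsets_def)
    then obtain h where h: "bij_betw h {..m} H" "strict_mono_on {..m} h"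
      by (metis ex_bij_betw_strict_mono_card lessThan_Suc_atMost)
    have "h ` A \<in> nsets H m" if "A \<subseteq> {..m}" "card A = m" for A
    proof -
      have "card (h ` A) = m"
        by (metis that bij_betw_imp_inj_on card_image h(1) inj_on_subset)
      moreover have "h ` A \<subseteq> H"
        using h(1) that by (auto simp: bij_betw_def)
      ultimately show ?thesis
        using \<open>finite H\<close> finite_subset by (auto simp: nsets_def)
    qed
    moreover have "{..<m} \<subseteq> {..m}" "{0<..m} \<subseteq> {..m}"
      by auto
    ultimately have "h ` {..<m} \<in> nsets H m" "h ` {0<..m} \<in> nsets H m"
      by simp_all
    then have "f (h ` {..<m}) = i" "f (h ` {0<..m}) = i"
      using mono by auto
    then show "\<exists>h. strict_mono_on {..m} h \<and> h ` {..m} \<subseteq> {..<n} \<and> f (h ` {..<m}) = f (h ` {0<..m})"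
      using h \<open>H \<subseteq> {..<n}\<close> by (auto simp: bij_betw_def intro!: exI[of _ h])
  qed
qed

section \<open>Products of forcing families\<close>

lemma finite_injection_lessThan:
  assumes "finite F"
  obtains code :: "'a \<Rightarrow> nat" where "inj_on code F" "\<And>x. x \<in> F \<Longrightarrow> code x < card F"
  proof -
  obtain code where code: "bij_betw code F {0..<card F}"
    using ex_bij_betw_finite_nat[OF assms] by blast
  show thesis
  proof (rule that)
    show "inj_on code F" using code by (rule bij_betw_imp_inj_on)
    show "code x < card F" if "x \<in> F" for x
      using bij_betwE[OF code] that by auto
  qed
qed

text \<open>
The product argument, in an abstract form. A map \<open>\<psi> \<in> \<Phi>\<close> is one of the admissible ways of realising
the labels as vectors, and the hypothesis says that finitely many of them suffice to make the
movable labels \<open>M\<close> monochromatic, for any number of colours. The conclusion concerns \<open>n\<close> independent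
blocks: the colour of a vector of labels does not change when movable labels are exchanged for
movable ones, whatever the other blocks contain. It matters that the other blocks may contain
labels outside \<open>M\<close>: about their colours nothing is known, but there are only finitely many of them,
so that the colour of a block can record what happens for each choice of the others and still takes
finitely many values.
\<close>

lemma product_forcing:
  fixes \<Phi> :: "('l \<Rightarrow> 'v) set" and L M :: "'l set" and K :: nat
  assumes "finite L"
    and force: "\<And>K. \<exists>\<Psi>. finite \<Psi> \<and> \<Psi> \<subseteq> \<Phi> \<and>
      (\<forall>c. (\<forall>v. c v < K) \<longrightarrow> (\<exists>\<psi>\<in>\<Psi>. \<forall>a\<in>M. \<forall>b\<in>M. c (\<psi> a) = (c (\<psi> b) :: nat)))"
  shows "\<exists>\<Psi>. finite \<Psi> \<and> \<Psi> \<subseteq> \<Phi> \<and>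
      (\<forall>C. (\<forall>vs. C vs < K) \<longrightarrow> (\<exists>\<psi>s. length \<psi>s = n \<and> set \<psi>s \<subseteq> \<Psi> \<and>
         (\<forall>as\<in>lists L. \<forall>bs\<in>lists L. length as = n \<longrightarrow>
            list_all2 (\<lambda>a b. a = b \<or> a \<in> M \<and> b \<in> M) as bs \<longrightarrow>
            C (map2 (\<lambda>\<psi> a. \<psi> a) \<psi>s as) = (C (map2 (\<lambda>\<psi> a. \<psi> a) \<psi>s bs) :: nat))))"
proof (induction n arbitrary: K)
  case 0
  show ?case by (rule exI[of _ "{}"]) simp
next
  case (Suc n)
  (* The head block gets its finite supply \<Psi>0 first, big enough to make the whole table of
     colours of the tails irrelevant; the tail is then asked to cope with every vector V that the
     head could still become. The copies are picked in the opposite order, tail before head. *)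
  let ?ap = "map2 (\<lambda>\<psi> a. \<psi> a) :: ('l \<Rightarrow> 'v) list \<Rightarrow> _"
  define W where "W = {as. set as \<subseteq> L \<and> length as = n}"
  define F where "F = W \<rightarrow>\<^sub>E {..<K}"
  have "finite W"
    unfolding W_def by (rule finite_lists_length_eq[OF \<open>finite L\<close>])
  then have "finite F"
    unfolding F_def by (simp add: finite_PiE)
  then obtain code where code: "inj_on code F" "\<And>x. x \<in> F \<Longrightarrow> code x < card F"
    using finite_injection_lessThan by blast
  obtain \<Psi>0 where \<Psi>0: "finite \<Psi>0" "\<Psi>0 \<subseteq> \<Phi>"
    "\<And>c. (\<And>v. c v < card F) \<Longrightarrow> \<exists>\<psi>\<in>\<Psi>0. \<forall>a\<in>M. \<forall>b\<in>M. c (\<psi> a) = c (\<psi> b)"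
    using force[of "card F"] by blast
  define V where "V = (\<Union>\<psi>\<in>\<Psi>0. \<psi> ` L)"
  define G where "G = V \<rightarrow>\<^sub>E {..<K}"
  have "finite V"
    using \<Psi>0(1) \<open>finite L\<close> by (simp add: V_def)
  then have "finite G"
    unfolding G_def by (simp add: finite_PiE)
  then obtain code' where code': "inj_on code' G" "\<And>x. x \<in> G \<Longrightarrow> code' x < card G"
    using finite_injection_lessThan by blast
  obtain \<Psi>1 where \<Psi>1: "finite \<Psi>1" "\<Psi>1 \<subseteq> \<Phi>"
    "\<And>C. (\<And>vs. C vs < card G) \<Longrightarrow> \<exists>\<psi>s. length \<psi>s = n \<and> set \<psi>s \<subseteq> \<Psi>1 \<and>
         (\<forall>as\<in>lists L. \<forall>bs\<in>lists L. length as = n \<longrightarrow>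
            list_all2 (\<lambda>a b. a = b \<or> a \<in> M \<and> b \<in> M) as bs \<longrightarrow> C (?ap \<psi>s as) = C (?ap \<psi>s bs))"
    using Suc.IH[of "card G"] by blast
  show ?case
  proof (intro exI[of _ "\<Psi>0 \<union> \<Psi>1"] conjI allI impI)
    show "finite (\<Psi>0 \<union> \<Psi>1)" "\<Psi>0 \<union> \<Psi>1 \<subseteq> \<Phi>"
      using \<Psi>0 \<Psi>1 by auto
    fix C :: "'v list \<Rightarrow> nat"
    assume C: "\<forall>vs. C vs < K"
    define g where "g vs = restrict (\<lambda>v. C (v # vs)) V" for vs
    have gG: "g vs \<in> G" for vs
      using C by (auto simp: g_def G_def)
    obtain \<psi>s where \<psi>s: "length \<psi>s = n" "set \<psi>s \<subseteq> \<Psi>1"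
      and tail: "\<And>as bs. \<lbrakk>as \<in> lists L; bs \<in> lists L; length as = n;
            list_all2 (\<lambda>a b. a = b \<or> a \<in> M \<and> b \<in> M) as bs\<rbrakk>
            \<Longrightarrow> code' (g (?ap \<psi>s as)) = code' (g (?ap \<psi>s bs))"
      using \<Psi>1(3)[of "\<lambda>vs. code' (g vs)"] code'(2) gG by blast
    define f where "f v = restrict (\<lambda>as. C (v # ?ap \<psi>s as)) W" for v
    have fF: "f v \<in> F" for v
      using C by (auto simp: f_def F_def)
    obtain \<psi> where \<psi>: "\<psi> \<in> \<Psi>0"
      and head: "\<And>a b. a \<in> M \<Longrightarrow> b \<in> M \<Longrightarrow> code (f (\<psi> a)) = code (f (\<psi> b))"
      using \<Psi>0(3)[of "\<lambda>v. code (f v)"] code(2) fF by blast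
    have step: "C (\<psi> a # ?ap \<psi>s as) = C (\<psi> b # ?ap \<psi>s bs)"
      if "a \<in> L" "as \<in> lists L" "bs \<in> lists L" "length as = n"
        "a = b \<or> a \<in> M \<and> b \<in> M" "list_all2 (\<lambda>a b. a = b \<or> a \<in> M \<and> b \<in> M) as bs"
      for a b as bs
    proof -
      have "g (?ap \<psi>s as) = g (?ap \<psi>s bs)"
        using tail[OF that(2-4,6)] code'(1) gG by (meson inj_onD)
      then have "g (?ap \<psi>s as) (\<psi> a) = g (?ap \<psi>s bs) (\<psi> a)"
        by (rule fun_cong)
      moreover have "\<psi> a \<in> V"
        using \<psi> \<open>a \<in> L\<close> by (auto simp: V_def)
      ultimately have "C (\<psi> a # ?ap \<psi>s as) = C (\<psi> a # ?ap \<psi>s bs)"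
        by (simp add: g_def)
      also have "\<dots> = C (\<psi> b # ?ap \<psi>s bs)"
      proof (cases "a = b")
        case False
        then have "f (\<psi> a) = f (\<psi> b)"
          using head that(5) code(1) fF by (meson inj_onD)
        then have "f (\<psi> a) bs = f (\<psi> b) bs"
          by (rule fun_cong)
        moreover have "bs \<in> W"
          using that(3,4) list_all2_lengthD[OF that(6)] by (auto simp: W_def)
        ultimately show ?thesis
          by (simp add: f_def)
      qed simp
      finally show ?thesis .
    qed
    show "\<exists>\<psi>s. length \<psi>s = Suc n \<and> set \<psi>s \<subseteq> \<Psi>0 \<union> \<Psi>1 \<and>
         (\<forall>as\<in>lists L. \<forall>bs\<in>lists L. length as = Suc n \<longrightarrow>
            list_all2 (\<lambda>a b. a = b \<or> a \<in> M \<and> b \<in> M) as bs \<longrightarrow> C (?ap \<psi>s as) = C (?ap \<psi>s bs))"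
    proof (intro exI[of _ "\<psi> # \<psi>s"] conjI ballI impI)
      fix as bs
      assume "as \<in> lists L" "bs \<in> lists L" "length as = Suc n"
        "list_all2 (\<lambda>a b. a = b \<or> a \<in> M \<and> b \<in> M) as bs"
      then obtain a as' b bs' where "as = a # as'" "bs = b # bs'"
        "a \<in> L" "as' \<in> lists L" "bs' \<in> lists L" "length as' = n"
        "a = b \<or> a \<in> M \<and> b \<in> M" "list_all2 (\<lambda>a b. a = b \<or> a \<in> M \<and> b \<in> M) as' bs'"
        by (cases as; cases bs) simp_all
      then show "C (?ap (\<psi> # \<psi>s) as) = C (?ap (\<psi> # \<psi>s) bs)"
        using step by simp
    qed (use \<psi> \<psi>s in auto)
  qed
qed

section \<open>Isometric embeddings and compactness\<close>

definition isometric_embedding :: "'b::metric_space set \<Rightarrow> nat \<Rightarrow> ('b \<Rightarrow> nat \<Rightarrow> real) \<Rightarrow> bool" where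
  "isometric_embedding E N \<psi> \<longleftrightarrow>
     \<psi> \<in> E \<rightarrow> topspace (Euclidean_space N) \<and>
     (\<forall>x\<in>E. \<forall>y\<in>E. euclidean_dist N (\<psi> x) (\<psi> y) = dist x y)"

lemma monochromatic_copy_iff:
  "monochromatic_copy X N c \<phi> \<longleftrightarrow>
     isometric_embedding X N \<phi> \<and> (\<forall>x\<in>X. \<forall>y\<in>X. c (\<phi> x) = c (\<phi> y))"
  by (auto simp: monochromatic_copy_def isometric_embedding_def)

lemma isometric_embedding_mono:
  assumes "isometric_embedding E N \<psi>" "N \<le> N'"
  shows "isometric_embedding E N' \<psi>"
proof -
  have *: "\<psi> x \<in> topspace (Euclidean_space N')" if "x \<in> E" for x
    using assms that by (auto simp: isometric_embedding_def topspace_Euclidean_space Pi_iff)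
  have "euclidean_dist N' (\<psi> x) (\<psi> y) = euclidean_dist N (\<psi> x) (\<psi> y)" if "x \<in> E" "y \<in> E" for x y
  proof -
    have "\<psi> x i = 0" "\<psi> y i = 0" if "i \<ge> N" for i
      using assms \<open>x \<in> E\<close> \<open>y \<in> E\<close> that by (auto simp: isometric_embedding_def topspace_Euclidean_space Pi_iff)
    then have "(\<Sum>i<N'. (\<psi> x i - \<psi> y i)\<^sup>2) = (\<Sum>i<N. (\<psi> x i - \<psi> y i)\<^sup>2)"
      using assms(2) by (intro sum.mono_neutral_right) auto
    then show ?thesis
      by (simp add: euclidean_dist_def L2_set_def)
  qed
  then show ?thesis
    using assms(1) * by (simp add: isometric_embedding_def)
qed

text \<open>
Compactness. By Tychonoff's theorem the space of all colourings is compact, and the colourings for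
which a given copy of \<open>X\<close> is monochromatic in a given colour form an open set, because \<open>X\<close> is finite.
These sets cover the space, so finitely many of them do.
\<close>

lemma finitely_many_copies_suffice:
  fixes X :: "'a::euclidean_space set" and k :: nat
  assumes "ramsey_set X" and "X \<noteq> {}"
  shows "\<exists>N \<Phi>. finite \<Phi> \<and> (\<forall>\<phi>\<in>\<Phi>. isometric_embedding X N \<phi>) \<and>
           (\<forall>c. (\<forall>v. c v < k) \<longrightarrow> (\<exists>\<phi>\<in>\<Phi>. \<forall>x\<in>X. \<forall>y\<in>X. c (\<phi> x) = c (\<phi> y)))"
proof (cases "k = 0")
  case True
  then show ?thesis by (intro exI[of _ 0] exI[of _ "{}"]) auto
next
  case False
  then have "k \<ge> 1"
    by simp
  then obtain N where N: "\<And>c. c \<in> topspace (Euclidean_space N) \<rightarrow> {..<k} \<Longrightarrow> \<exists>\<phi>. monochromatic_copy X N c \<phi>"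
    using assms(1) unfolding ramsey_set_def by blast
  have "finite X"
    using assms(1) by (simp add: ramsey_set_def)
  let ?E = "topspace (Euclidean_space N)"
  let ?T = "product_topology (\<lambda>_. discrete_topology {..<k}) ?E"
  have compact: "compact_space ?T"
    unfolding compact_space_product_topology by (simp add: compact_space_discrete_topology)
  define U where "U \<phi> i = (\<Pi>\<^sub>E v\<in>?E. if v \<in> \<phi> ` X then {i} else {..<k})"
    for \<phi> :: "'a \<Rightarrow> nat \<Rightarrow> real" and i :: nat
  define I where "I = {\<phi>. isometric_embedding X N \<phi>} \<times> {..<k}"
  have openU: "openin ?T (U \<phi> i)" if "i < k" for \<phi> i
  proof -
    have "finite (\<phi> ` X)" using \<open>finite X\<close> by simp
    moreover have "{v \<in> ?E. (if v \<in> \<phi> ` X then {i} else {..<k}) \<noteq> {..<k}} \<subseteq> \<phi> ` X"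
      by auto
    ultimately have "finite {v \<in> ?E. (if v \<in> \<phi> ` X then {i} else {..<k}) \<noteq> {..<k}}"
      using finite_subset by blast
    then show ?thesis
      unfolding U_def openin_PiE_gen using that by simp
  qed
  have cover: "topspace ?T \<subseteq> (\<Union>(\<phi>, i)\<in>I. U \<phi> i)"
  proof
    fix c assume "c \<in> topspace ?T"
    then have c: "c \<in> ?E \<rightarrow>\<^sub>E {..<k}" by simp
    then have "c \<in> ?E \<rightarrow> {..<k}" by auto
    then obtain \<phi> where \<phi>: "isometric_embedding X N \<phi>" "\<And>x y. x \<in> X \<Longrightarrow> y \<in> X \<Longrightarrow> c (\<phi> x) = c (\<phi> y)"
      using N[of c] unfolding monochromatic_copy_iff by blast
    obtain x0 where "x0 \<in> X" using assms(2) by auto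
    then have "\<phi> x0 \<in> ?E" using \<phi>(1) by (auto simp: isometric_embedding_def)
    then have "c (\<phi> x0) < k" using c by auto
    moreover have "c \<in> U \<phi> (c (\<phi> x0))"
    proof -
      define i where "i = c (\<phi> x0)"
      have "c (\<phi> x) = i" if "x \<in> X" for x
        using \<phi>(2)[OF that \<open>x0 \<in> X\<close>] by (simp add: i_def)
      then show ?thesis
        using c unfolding i_def[symmetric] by (auto simp: U_def PiE_iff)
    qed
    ultimately show "c \<in> (\<Union>(\<phi>, i)\<in>I. U \<phi> i)"
      using \<phi>(1) by (auto simp: I_def)
  qed
  have "\<exists>\<F>. finite \<F> \<and> \<F> \<subseteq> (\<lambda>(\<phi>, i). U \<phi> i) ` I \<and> topspace ?T \<subseteq> \<Union>\<F>"
    using compact[unfolded compact_space_alt, rule_format, of "(\<lambda>(\<phi>, i). U \<phi> i) ` I"] cover openU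
    by (auto simp: I_def)
  then obtain \<F> where \<F>: "finite \<F>" "\<F> \<subseteq> (\<lambda>(\<phi>, i). U \<phi> i) ` I" "topspace ?T \<subseteq> \<Union>\<F>"
    by blast
  obtain J where J: "finite J" "J \<subseteq> I" "\<F> = (\<lambda>(\<phi>, i). U \<phi> i) ` J"
    using finite_subset_image[OF \<F>(1,2)] by blast
  show ?thesis
  proof (intro exI[of _ N] exI[of _ "fst ` J"] conjI ballI allI impI)
    show "finite (fst ` J)" using J by simp
    show "isometric_embedding X N \<phi>" if "\<phi> \<in> fst ` J" for \<phi>
      using that J(2) by (auto simp: I_def)
    fix c :: "(nat \<Rightarrow> real) \<Rightarrow> nat"
    assume "\<forall>v. c v < k"
    then have "restrict c ?E \<in> topspace ?T" by auto
    then obtain \<phi> i where \<phi>: "(\<phi>, i) \<in> J" "restrict c ?E \<in> U \<phi> i"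
      using \<F>(3) J(3) by blast
    have "c (\<phi> x) = i" if "x \<in> X" for x
    proof -
      have "\<phi> x \<in> ?E"
        using \<phi>(1) J(2) that by (auto simp: I_def isometric_embedding_def)
      then have "restrict c ?E (\<phi> x) \<in> {i}"
        using PiE_mem[OF \<phi>(2)[unfolded U_def], of "\<phi> x"] that by simp
      then show ?thesis
        using \<open>\<phi> x \<in> ?E\<close> by simp
    qed
    then show "\<exists>\<phi>\<in>fst ` J. \<forall>x\<in>X. \<forall>y\<in>X. c (\<phi> x) = c (\<phi> y)"
      using \<phi>(1) by (auto intro!: bexI[of _ "(\<phi>, i)"])
  qed
qed

section \<open>Extending an isometry to the affine hull and one more dimension\<close>

text \<open>
A combination of points with weights of sum zero has a length that depends only on the distances
between the points. This is how isometries of \<open>X\<close> extend to affine combinations of \<open>X\<close>, even if \<open>X\<close> is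
affinely dependent and the combinations are not unique.
\<close>

lemma sum_squares_zero_weights:
  fixes d :: "'x \<Rightarrow> real" and g :: "'i \<Rightarrow> 'x \<Rightarrow> real"
  assumes "(\<Sum>x\<in>X. d x) = 0"
  shows "(\<Sum>i\<in>I. (\<Sum>x\<in>X. d x * g i x)\<^sup>2) =
         - (\<Sum>x\<in>X. \<Sum>y\<in>X. d x * d y * (\<Sum>i\<in>I. (g i x - g i y)\<^sup>2)) / 2"
proof -
  have one: "(\<Sum>x\<in>X. \<Sum>y\<in>X. d x * d y * (f x - f y)\<^sup>2) = - 2 * (\<Sum>x\<in>X. d x * f x)\<^sup>2" for f :: "'x \<Rightarrow> real"
  proof -
    have "(\<Sum>x\<in>X. \<Sum>y\<in>X. d x * d y * (f x - f y)\<^sup>2) =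
        (\<Sum>x\<in>X. \<Sum>y\<in>X. (d x * (f x)\<^sup>2) * d y + d x * (d y * (f y)\<^sup>2) - (2 * (d x * f x)) * (d y * f y))"
      by (intro sum.cong refl) (simp add: power2_eq_square algebra_simps)
    also have "\<dots> = (\<Sum>x\<in>X. d x * (f x)\<^sup>2) * (\<Sum>y\<in>X. d y) + (\<Sum>x\<in>X. d x) * (\<Sum>y\<in>X. d y * (f y)\<^sup>2)
        - (\<Sum>x\<in>X. 2 * (d x * f x)) * (\<Sum>y\<in>X. d y * f y)"
      by (simp only: sum_product sum.distrib sum_subtractf)
    finally show ?thesis
      using assms by (simp add: power2_eq_square flip: sum_distrib_left)
  qed
  have "(\<Sum>x\<in>X. \<Sum>y\<in>X. d x * d y * (\<Sum>i\<in>I. (g i x - g i y)\<^sup>2)) =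
      (\<Sum>i\<in>I. \<Sum>x\<in>X. \<Sum>y\<in>X. d x * d y * (g i x - g i y)\<^sup>2)"
  proof -
    have "(\<Sum>x\<in>X. \<Sum>y\<in>X. d x * d y * (\<Sum>i\<in>I. (g i x - g i y)\<^sup>2)) =
        (\<Sum>x\<in>X. \<Sum>i\<in>I. \<Sum>y\<in>X. d x * d y * (g i x - g i y)\<^sup>2)"
      unfolding sum_distrib_left by (intro sum.cong refl sum.swap)
    also have "\<dots> = (\<Sum>i\<in>I. \<Sum>x\<in>X. \<Sum>y\<in>X. d x * d y * (g i x - g i y)\<^sup>2)"
      by (rule sum.swap)
    finally show ?thesis .
  qed
  then show ?thesis
    by (simp add: one sum_distrib_left[symmetric] sum_negf)
qed

lemma euclidean_dist_power2: "(euclidean_dist N v w)\<^sup>2 = (\<Sum>i<N. (v i - w i)\<^sup>2)"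
  by (simp add: euclidean_dist_def L2_set_def sum_nonneg)

lemma power2_dist_Basis: "(dist x y)\<^sup>2 = (\<Sum>b\<in>Basis. (x \<bullet> b - y \<bullet> b)\<^sup>2)"
  for x y :: "'a::euclidean_space"
proof -
  have "(dist x y)\<^sup>2 = (x - y) \<bullet> (x - y)"
    by (simp add: dist_norm power2_norm_eq_inner)
  also have "\<dots> = (\<Sum>b\<in>Basis. (x \<bullet> b - y \<bullet> b)\<^sup>2)"
    by (subst euclidean_inner) (simp add: inner_diff_left power2_eq_square)
  finally show ?thesis .
qed

text \<open>
The factor \<open>\<real>\<close> supplies a direction orthogonal to the copy of \<open>X\<close>; its coordinate is put in front, so
that it does not depend on \<open>N\<close>.
\<close>

lemma isometric_embedding_extend:
  fixes X :: "'a::euclidean_space set"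
  assumes "finite X" "isometric_embedding X N \<phi>"
  shows "\<exists>\<psi>. isometric_embedding ((affine hull X) \<times> (UNIV :: real set)) (Suc N) \<psi> \<and>
    (\<forall>x\<in>X. \<psi> (x, 0) = case_nat 0 (\<phi> x))"
proof -
  (* A point of X gets its trivial representation, which makes \<psi> extend \<phi> on the nose. *)
  have "\<exists>u. sum u X = 1 \<and> (\<Sum>x\<in>X. u x *\<^sub>R x) = q \<and> (q \<in> X \<longrightarrow> u = (\<lambda>x. if x = q then 1 else 0))"
    if "q \<in> affine hull X" for q
  proof (cases "q \<in> X")
    case True
    have "(\<Sum>x\<in>X. (if x = q then 1 else 0) *\<^sub>R x) = (\<Sum>x\<in>X. if x = q then x else 0)"
      by (intro sum.cong) auto
    with True show ?thesis
      using assms(1) by (intro exI[of _ "\<lambda>x. if x = q then 1 else 0"]) simp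
  next
    case False
    with that show ?thesis
      unfolding affine_hull_finite[OF assms(1)] by auto
  qed
  then have "\<exists>w. \<forall>q\<in>affine hull X. sum (w q) X = 1 \<and> (\<Sum>x\<in>X. w q x *\<^sub>R x) = q \<and>
      (q \<in> X \<longrightarrow> w q = (\<lambda>x. if x = q then 1 else 0))"
    by (intro bchoice ballI)
  then obtain w where w: "\<And>q. q \<in> affine hull X \<Longrightarrow> sum (w q) X = 1"
    "\<And>q. q \<in> affine hull X \<Longrightarrow> (\<Sum>x\<in>X. w q x *\<^sub>R x) = q"
    "\<And>q. q \<in> X \<Longrightarrow> w q = (\<lambda>x. if x = q then 1 else 0)"
    using hull_inc[of _ X affine] by blast
  define \<psi> where "\<psi> = (\<lambda>(q, t). case_nat t (\<lambda>i. \<Sum>x\<in>X. w q x * \<phi> x i))"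
  have zero: "\<phi> x i = 0" if "x \<in> X" "i \<ge> N" for x i
    using assms(2) that by (auto simp: isometric_embedding_def topspace_Euclidean_space)
  have isometry: "euclidean_dist (Suc N) (\<psi> (q, t)) (\<psi> (r, s)) = dist (q, t) (r, s)"
    if "q \<in> affine hull X" "r \<in> affine hull X" for q r :: 'a and t s :: real
  proof -
    define d where "d x = w q x - w r x" for x
    have "sum d X = 0"
      using w(1) that by (simp add: d_def sum_subtractf)
    have qr: "q - r = (\<Sum>x\<in>X. d x *\<^sub>R x)"
      using w(2) that by (simp add: d_def scaleR_diff_left sum_subtractf)
    have "(\<Sum>i<N. ((\<Sum>x\<in>X. w q x * \<phi> x i) - (\<Sum>x\<in>X. w r x * \<phi> x i))\<^sup>2)
        = (\<Sum>i<N. (\<Sum>x\<in>X. d x * \<phi> x i)\<^sup>2)"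
      by (simp add: d_def left_diff_distrib sum_subtractf)
    also have "\<dots> = - (\<Sum>x\<in>X. \<Sum>y\<in>X. d x * d y * (euclidean_dist N (\<phi> x) (\<phi> y))\<^sup>2) / 2"
      unfolding euclidean_dist_power2
      by (rule sum_squares_zero_weights[where g = "\<lambda>i x. \<phi> x i", OF \<open>sum d X = 0\<close>])
    also have "\<dots> = - (\<Sum>x\<in>X. \<Sum>y\<in>X. d x * d y * (dist x y)\<^sup>2) / 2"
      using assms(2) by (simp add: isometric_embedding_def)
    also have "\<dots> = (\<Sum>b\<in>Basis. (\<Sum>x\<in>X. d x * (x \<bullet> b))\<^sup>2)"
      unfolding power2_dist_Basis
      by (rule sum_squares_zero_weights[where g = "\<lambda>b x. x \<bullet> b", OF \<open>sum d X = 0\<close>, symmetric])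
    also have "\<dots> = (dist q r)\<^sup>2"
      by (simp add: power2_dist_Basis flip: inner_diff_left) (simp add: qr inner_sum_left)
    finally have "(euclidean_dist (Suc N) (\<psi> (q, t)) (\<psi> (r, s)))\<^sup>2 = (dist (q, t) (r, s))\<^sup>2"
      by (simp add: euclidean_dist_power2 \<psi>_def sum.lessThan_Suc_shift dist_Pair_Pair dist_real_def
          del: sum.lessThan_Suc)
    then show ?thesis
      by (simp add: euclidean_dist_def)
  qed
  have carrier: "\<psi> (q, t) \<in> topspace (Euclidean_space (Suc N))" for q t
    using zero by (auto simp: \<psi>_def topspace_Euclidean_space split: nat.split)
  have base: "\<psi> (x, 0) = case_nat 0 (\<phi> x)" if "x \<in> X" for x
  proof -
    have "(\<Sum>y\<in>X. w x y * \<phi> y i) = (\<Sum>y\<in>X. if y = x then \<phi> y i else 0)" for i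
      using that by (intro sum.cong) (auto simp: w(3))
    then show ?thesis
      using that assms(1) by (simp add: \<psi>_def)
  qed
  show ?thesis
  proof (intro exI[of _ \<psi>] conjI ballI)
    show "isometric_embedding ((affine hull X) \<times> (UNIV :: real set)) (Suc N) \<psi>"
      unfolding isometric_embedding_def using isometry carrier by auto
  qed (rule base)
qed

section \<open>Orthogonal sums\<close>

text \<open>
The orthogonal sum of \<open>n\<close> copies of \<open>\<real>\<^sup>d\<close>, with the blocks laid out one after the other.
\<close>

definition stack :: "nat \<Rightarrow> nat \<Rightarrow> (nat \<Rightarrow> real) list \<Rightarrow> nat \<Rightarrow> real" where
  "stack n d vs i = (if i < n * d then (vs ! (i div d)) (i mod d) else 0)"

lemma stack_in_Euclidean_space: "stack n d vs \<in> topspace (Euclidean_space (n * d))"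
  by (simp add: topspace_Euclidean_space stack_def)

lemma euclidean_dist_stack:
  "(euclidean_dist (n * d) (stack n d vs) (stack n d ws))\<^sup>2 =
     (\<Sum>j<n. (euclidean_dist d (vs ! j) (ws ! j))\<^sup>2)"
proof -
  let ?D = "\<lambda>i. (stack n d vs i - stack n d ws i)\<^sup>2"
  have "(\<Sum>i<n * d. ?D i) = (\<Sum>j<n. \<Sum>i\<in>{j * d..<j * d + d}. ?D i)"
    by (rule sum.nat_group[symmetric])
  also have "\<dots> = (\<Sum>j<n. \<Sum>i<d. ((vs ! j) i - (ws ! j) i)\<^sup>2)"
  proof (rule sum.cong[OF refl])
    fix j assume "j \<in> {..<n}"
    have eq: "?D (i + j * d) = ((vs ! j) i - (ws ! j) i)\<^sup>2" if "i < d" for i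
    proof -
      have "i + j * d < Suc j * d" using that by simp
      also have "\<dots> \<le> n * d" using \<open>j \<in> {..<n}\<close> by (intro mult_le_mono1) simp
      finally show ?thesis
        using that by (simp add: stack_def)
    qed
    have "(\<Sum>i\<in>{j * d..<j * d + d}. ?D i) = (\<Sum>i\<in>{0..<d}. ?D (i + j * d))"
      using sum.shift_bounds_nat_ivl[of ?D 0 "j * d" d] by (simp add: add.commute)
    also have "\<dots> = (\<Sum>i<d. ((vs ! j) i - (ws ! j) i)\<^sup>2)"
      using eq by (intro sum.cong) auto
    finally show "(\<Sum>i\<in>{j * d..<j * d + d}. ?D i) = (\<Sum>i<d. ((vs ! j) i - (ws ! j) i)\<^sup>2)" .
  qed
  finally show ?thesis
    by (simp add: euclidean_dist_power2)
qed

section \<open>Path argument\<close>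

text \<open>
The core of the proof. Let \<open>q\<close> be a path that ends in \<open>M\<close>. Each block \<open>j < n\<close> carries a label. For a set
\<open>J\<close> of blocks, let the \<open>r\<close>-th block of \<open>J\<close> carry \<open>q r\<close>, and let the blocks outside \<open>J\<close> carry the end \<open>q m\<close>
of the path. Take two consecutive windows \<open>h ` {..<m}\<close> and \<open>h ` {0<..m}\<close> of the same colour.
In the later window, the block \<open>h 0\<close> carries a movable label; moving it over \<open>M\<close> gives a copy of \<open>M\<close>
without a change of colour. The earlier window is the apex: in \<open>h 0\<close> it carries \<open>q 0\<close>, and in
\<open>h (r + 1)\<close> it carries \<open>q (r + 1)\<close> where the copy carries \<open>q r\<close>. So the apex is as far from the copy as \<open>q 0\<close>
is from \<open>M\<close>, up to the sum of the squared steps of the path, and this sum is small for a path with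
many short steps. The end \<open>q m\<close> lies in \<open>M\<close> because the block \<open>h 0\<close> has to be movable although the
later window does not reach it.
\<close>

lemma path_forcing:
  fixes E M :: "'b::metric_space set" and q :: "nat \<Rightarrow> 'b" and m k :: nat
  assumes "finite M" "M \<subseteq> E" "q ` {..m} \<subseteq> E" "q m \<in> M"
    and force: "\<And>K::nat. \<exists>N \<Psi>. finite \<Psi> \<and> (\<forall>\<psi>\<in>\<Psi>. isometric_embedding E N \<psi>) \<and>
      (\<forall>c. (\<forall>v. c v < K) \<longrightarrow> (\<exists>\<psi>\<in>\<Psi>. \<forall>a\<in>M. \<forall>b\<in>M. c (\<psi> a) = c (\<psi> b)))"
  shows "\<exists>D. \<forall>c. (\<forall>v. c v < k) \<longrightarrow>
    (\<exists>\<theta> w. isometric_embedding M D \<theta> \<and> w \<in> topspace (Euclidean_space D) \<and>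
      (\<forall>a\<in>M. c (\<theta> a) = c w \<and>
        (euclidean_dist D (\<theta> a) w)\<^sup>2 = (dist a (q 0))\<^sup>2 + (\<Sum>r<m. (dist (q r) (q (Suc r)))\<^sup>2)))"
proof -
  define L where "L = M \<union> q ` {..m}"
  have L: "finite L" "M \<subseteq> L" "L \<subseteq> E"
    using assms(1-3) by (auto simp: L_def)
  let ?ap = "map2 (\<lambda>\<psi> a. \<psi> a) :: ('b \<Rightarrow> nat \<Rightarrow> real) list \<Rightarrow> _"
  obtain n :: nat where n: "\<forall>f. (\<forall>J. f J < k) \<longrightarrow>
     (\<exists>h. strict_mono_on {..m} h \<and> h ` {..m} \<subseteq> {..<n} \<and> f (h ` {..<m}) = f (h ` {0<..m}))"
    using consecutive_sets_same_colour[of k m] by (rule exE)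
  have "\<exists>\<Psi>. finite \<Psi> \<and> \<Psi> \<subseteq> {\<psi>. \<exists>N. isometric_embedding E N \<psi>} \<and>
      (\<forall>c. (\<forall>v. c v < K) \<longrightarrow> (\<exists>\<psi>\<in>\<Psi>. \<forall>a\<in>M. \<forall>b\<in>M. c (\<psi> a) = c (\<psi> b)))" for K :: nat
    using force[of K] by blast
  from product_forcing[OF L(1) this, of k n]
  obtain \<Psi> where \<Psi>: "finite \<Psi>" "\<Psi> \<subseteq> {\<psi>. \<exists>N. isometric_embedding E N \<psi>}"
    "\<forall>C. (\<forall>vs. C vs < k) \<longrightarrow> (\<exists>\<psi>s. length \<psi>s = n \<and> set \<psi>s \<subseteq> \<Psi> \<and>
         (\<forall>as\<in>lists L. \<forall>bs\<in>lists L. length as = n \<longrightarrow>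
            list_all2 (\<lambda>a b. a = b \<or> a \<in> M \<and> b \<in> M) as bs \<longrightarrow> C (?ap \<psi>s as) = C (?ap \<psi>s bs)))"
    by (elim exE conjE)
  have "\<exists>N. \<forall>\<psi>\<in>\<Psi>. isometric_embedding E N \<psi>"
  proof -
    have "\<exists>Nf. \<forall>\<psi>\<in>\<Psi>. isometric_embedding E (Nf \<psi>) \<psi>"
      using \<Psi>(2) by (intro bchoice) blast
    then obtain Nf where Nf: "\<And>\<psi>. \<psi> \<in> \<Psi> \<Longrightarrow> isometric_embedding E (Nf \<psi>) \<psi>"
      by blast
    have "Nf \<psi> \<le> sum Nf \<Psi>" if "\<psi> \<in> \<Psi>" for \<psi>
      using \<Psi>(1) that by (simp add: member_le_sum)
    then show ?thesis
      using Nf isometric_embedding_mono by blast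
  qed
  then obtain N where N: "\<And>\<psi>. \<psi> \<in> \<Psi> \<Longrightarrow> isometric_embedding E N \<psi>"
    by blast
  show ?thesis
  proof (intro exI[of _ "n * N"] allI impI)
    fix c :: "(nat \<Rightarrow> real) \<Rightarrow> nat"
    assume "\<forall>v. c v < k"
    then have c: "c v < k" for v by blast
    obtain \<psi>s where \<psi>s: "length \<psi>s = n" "set \<psi>s \<subseteq> \<Psi>"
      and invariant: "\<And>as bs. \<lbrakk>as \<in> lists L; bs \<in> lists L; length as = n;
            list_all2 (\<lambda>a b. a = b \<or> a \<in> M \<and> b \<in> M) as bs\<rbrakk>
            \<Longrightarrow> c (stack n N (?ap \<psi>s as)) = c (stack n N (?ap \<psi>s bs))"
      using \<Psi>(3)[rule_format, of "\<lambda>vs. c (stack n N vs)"] c by blast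
    (* Realising labels block by block is isometric, so that distances can be computed with labels. *)
    define place where "place as = stack n N (?ap \<psi>s as)" for as
    have dist_place: "(euclidean_dist (n * N) (place as) (place bs))\<^sup>2 = (\<Sum>j<n. (dist (as ! j) (bs ! j))\<^sup>2)"
      if "as \<in> lists L" "bs \<in> lists L" "length as = n" "length bs = n" for as bs
      unfolding place_def euclidean_dist_stack
    proof (rule sum.cong[OF refl])
      fix j assume "j \<in> {..<n}"
      then have "j < n" by simp
      then have "isometric_embedding E N (\<psi>s ! j)"
        using \<psi>s N[of "\<psi>s ! j"] nth_mem[of j \<psi>s] by blast
      moreover have "as ! j \<in> E" "bs ! j \<in> E"
        using that \<open>j < n\<close> L(3) by (auto simp: in_lists_conv_set)
      ultimately show "(euclidean_dist N (?ap \<psi>s as ! j) (?ap \<psi>s bs ! j))\<^sup>2 = (dist (as ! j) (bs ! j))\<^sup>2"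
        using that \<psi>s \<open>j < n\<close> by (simp add: isometric_embedding_def)
    qed
    define word where
      "word J = map (\<lambda>j. if j \<in> J then q (card {i\<in>J. i < j}) else q m) [0..<n]" for J
    obtain h where h: "strict_mono_on {..m} h" "h ` {..m} \<subseteq> {..<n}"
      and same: "c (place (word (h ` {..<m}))) = c (place (word (h ` {0<..m})))"
      using n[rule_format, of "\<lambda>J. c (place (word J))"] c by blast
    have less: "h r < h s \<longleftrightarrow> r < s" if "r \<le> m" "s \<le> m" for r s
      using strict_mono_on_less[OF h(1)] that by simp
    have inj: "inj_on h {..m}"
      by (rule strict_mono_on_imp_inj_on[OF h(1)])
    have hn: "h r < n" if "r \<le> m" for r
      using h(2) that by auto
    have mem: "h r \<in> h ` A \<longleftrightarrow> r \<in> A" if "r \<le> m" "A \<subseteq> {..m}" for r A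
      using inj_on_image_mem_iff[OF inj] that by simp
    (* The label of a block of J depends on its rank in J; for a window of h it is the offset from
       the start of the window. *)
    have rank: "card {i \<in> h ` A. i < h r} = card (A \<inter> {..<r})" if "r \<le> m" "A \<subseteq> {..m}" for r A
    proof -
      have "{i \<in> h ` A. i < h r} = h ` (A \<inter> {..<r})"
        using that less by auto
      moreover have "inj_on h (A \<inter> {..<r})"
        using inj that(2) by (meson inj_on_subset le_infI1)
      ultimately show ?thesis
        by (simp add: card_image)
    qed
    have sub: "{..<m} \<subseteq> {..m}" "{0<..m} \<subseteq> {..m}"
      by auto
    define early late where "early = word (h ` {..<m})" and "late = word (h ` {0<..m})"
    have early: "early ! h r = q r" if "r \<le> m" for r
    proof (cases "r = m")
      case True
      then show ?thesis
        using hn[OF that] mem[OF that sub(1)] by (simp add: early_def word_def)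
    next
      case False
      then have "r < m" using that by simp
      then have "{..<m} \<inter> {..<r} = {..<r}" by auto
      then show ?thesis
        using hn[OF that] mem[OF that sub(1)] rank[OF that sub(1)] \<open>r < m\<close>
        by (auto simp add: early_def word_def)
    qed
    have late: "late ! h (Suc r) = q r" if "r < m" for r
    proof -
      have "{0<..m} \<inter> {..<Suc r} = {0<..r}" using that by auto
      then show ?thesis
        using hn[of "Suc r"] mem[OF _ sub(2), of "Suc r"] rank[OF _ sub(2), of "Suc r"] that
        by (auto simp add: late_def word_def)
    qed
    have late0: "late ! h 0 = q m"
      using hn[of 0] mem[OF _ sub(2), of 0] by (auto simp add: late_def word_def)
    have other: "early ! j = q m" "late ! j = q m" if "j < n" "j \<notin> h ` {..m}" for j
      using that by (auto simp: early_def late_def word_def)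
    have len: "length early = n" "length late = n"
      by (simp_all add: early_def late_def word_def)
    have lists: "early \<in> lists L" "late \<in> lists L"
    proof -
      have "early ! j \<in> L \<and> late ! j \<in> L" if "j < n" for j
      proof (cases "j \<in> h ` {..m}")
        case True
        then obtain r where "j = h r" "r \<le> m" by auto
        then show ?thesis
          using early[of r] late[of "r - 1"] late0 by (cases r) (auto simp: L_def)
      next
        case False
        then show ?thesis
          using other[OF that] by (auto simp: L_def)
      qed
      then show "early \<in> lists L" "late \<in> lists L"
        using len by (auto simp: in_lists_conv_set in_set_conv_nth)
    qed
    (* The copy of M: only the block of h 0, on which late is movable, varies. *)
    define spot where "spot a = late[h 0 := a]" for a
    have spot: "spot a \<in> lists L" "length (spot a) = n" if "a \<in> M" for a
      using lists(2) len that L(2) set_update_subset_insert[of late "h 0" a]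
      by (auto simp: spot_def in_lists_conv_set)
    have spot0: "spot a ! h 0 = a" for a
      using hn[of 0] len by (simp add: spot_def)
    have spot_late: "spot a ! j = late ! j" if "j \<noteq> h 0" for a j
      using that by (simp add: spot_def)
    have colour: "c (place (spot a)) = c (place early)" if "a \<in> M" for a
    proof -
      have "list_all2 (\<lambda>a b. a = b \<or> a \<in> M \<and> b \<in> M) (spot a) late"
        unfolding list_all2_conv_all_nth
        using spot[OF that] len spot_late spot0 late0 that assms(4) by metis
      then have "c (place (spot a)) = c (place late)"
        unfolding place_def using invariant spot[OF that] lists(2) by blast
      then show ?thesis
        using same by (simp add: early_def late_def)
    qed
    have "(euclidean_dist (n * N) (place (spot a)) (place (spot b)))\<^sup>2 = (dist a b)\<^sup>2"
      if "a \<in> M" "b \<in> M" for a b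
    proof -
      have "(\<Sum>j<n. (dist (spot a ! j) (spot b ! j))\<^sup>2) = (\<Sum>j\<in>{h 0}. (dist (spot a ! j) (spot b ! j))\<^sup>2)"
        using hn[of 0] by (intro sum.mono_neutral_right) (auto simp: spot_late)
      then show ?thesis
        using that spot dist_place by (simp add: spot0)
    qed
    then have "isometric_embedding M (n * N) (\<lambda>a. place (spot a))"
      by (auto simp: isometric_embedding_def place_def stack_in_Euclidean_space euclidean_dist_def)
    moreover have "(euclidean_dist (n * N) (place (spot a)) (place early))\<^sup>2
        = (dist a (q 0))\<^sup>2 + (\<Sum>r<m. (dist (q r) (q (Suc r)))\<^sup>2)" if "a \<in> M" for a
    proof -
      (* Outside h ` {..m} both carry q m; at h m, the apex carries q m as well, because the earlier
         window ends just before. *)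
      let ?d = "\<lambda>j. (dist (spot a ! j) (early ! j))\<^sup>2"
      have "?d j = 0" if "j < n" "j \<notin> h ` {..m}" for j
        using other[OF that] spot_late[of j a] that by auto
      then have "(\<Sum>j<n. ?d j) = (\<Sum>j\<in>h ` {..m}. ?d j)"
        using h(2) by (intro sum.mono_neutral_right) auto
      also have "\<dots> = (\<Sum>r<Suc m. ?d (h r))"
        by (simp add: sum.reindex[OF inj] lessThan_Suc_atMost)
      also have "\<dots> = ?d (h 0) + (\<Sum>r<m. ?d (h (Suc r)))"
        by (rule sum.lessThan_Suc_shift)
      also have "?d (h 0) = (dist a (q 0))\<^sup>2"
        using early[of 0] by (simp add: spot0)
      also have "(\<Sum>r<m. ?d (h (Suc r))) = (\<Sum>r<m. (dist (q r) (q (Suc r)))\<^sup>2)"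
      proof (rule sum.cong[OF refl])
        fix r assume "r \<in> {..<m}"
        then have "r < m" by simp
        moreover have "h (Suc r) \<noteq> h 0"
          using less[of 0 "Suc r"] \<open>r < m\<close> by simp
        ultimately show "?d (h (Suc r)) = (dist (q r) (q (Suc r)))\<^sup>2"
          using early[of "Suc r"] late[of r] by (simp add: spot_late)
      qed
      finally show ?thesis
        using dist_place spot[OF that] lists(1) len(1) by simp
    qed
    ultimately show "\<exists>\<theta> w. isometric_embedding M (n * N) \<theta> \<and> w \<in> topspace (Euclidean_space (n * N)) \<and>
      (\<forall>a\<in>M. c (\<theta> a) = c w \<and>
        (euclidean_dist (n * N) (\<theta> a) w)\<^sup>2 = (dist a (q 0))\<^sup>2 + (\<Sum>r<m. (dist (q r) (q (Suc r)))\<^sup>2))"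
      using colour stack_in_Euclidean_space[of n N]
      by (intro exI[of _ "\<lambda>a. place (spot a)"] exI[of _ "place early"]) (simp add: place_def)
  qed
qed

section \<open>Adding a point outside the affine hull\<close>

text \<open>
The witness \<open>p\<close> is the foot of the perpendicular from \<open>z\<close> to the affine hull.
\<close>

lemma affine_hull_pythagoras:
  fixes z :: "'a::euclidean_space"
  assumes "X \<noteq> {}"
  shows "\<exists>p\<in>affine hull X. \<forall>x\<in>affine hull X. (dist z x)\<^sup>2 = (dist p x)\<^sup>2 + (dist z p)\<^sup>2"
proof -
  obtain x0 where "x0 \<in> X" using assms by auto
  let ?V = "span ((\<lambda>x. - x0 + x) ` X)"
  have hull: "affine hull X = (\<lambda>v. x0 + v) ` ?V"
    by (rule affine_hull_span_gen) (simp add: \<open>x0 \<in> X\<close> hull_inc)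
  obtain y n where y: "y \<in> ?V" and n: "\<And>w. w \<in> ?V \<Longrightarrow> orthogonal n w" and z: "z - x0 = y + n"
    using orthogonal_subspace_decomp_exists[of "(\<lambda>x. - x0 + x) ` X" "z - x0"] by blast
  have zp: "z - (x0 + y) = n"
    using z by (simp add: algebra_simps)
  show ?thesis
  proof (intro bexI[of _ "x0 + y"] ballI)
    show "x0 + y \<in> affine hull X"
      using hull y by blast
    fix x assume "x \<in> affine hull X"
    then obtain v where v: "v \<in> ?V" "x = x0 + v"
      using hull by blast
    then have "orthogonal (y - v) n"
      using n[of "y - v"] y by (simp add: span_diff orthogonal_commute)
    moreover have "z - x = (y - v) + n"
      using z v by (simp add: algebra_simps)
    moreover have "x0 + y - x = y - v"
      using v by simp
    ultimately show "(dist z x)\<^sup>2 = (dist (x0 + y) x)\<^sup>2 + (dist z (x0 + y))\<^sup>2"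
      by (simp only: dist_norm zp norm_add_Pythagorean)
  qed
qed

text \<open>
This is the hypothesis of the path argument for the movable labels \<open>X \<times> {0}\<close>: the embedding carries
along all points \<open>(p, t)\<close> with \<open>p\<close> in the affine hull of \<open>X\<close> at height \<open>t\<close> above it, but only the points
of \<open>X\<close> itself are made monochromatic.
\<close>

lemma ramsey_set_forces_extended_copies:
  fixes X :: "'a::euclidean_space set" and K :: nat
  assumes "ramsey_set X" "X \<noteq> {}"
  shows "\<exists>N \<Psi>. finite \<Psi> \<and>
      (\<forall>\<psi>\<in>\<Psi>. isometric_embedding ((affine hull X) \<times> (UNIV :: real set)) N \<psi>) \<and>
      (\<forall>c. (\<forall>v. c v < K) \<longrightarrow> (\<exists>\<psi>\<in>\<Psi>. \<forall>a\<in>X \<times> {0}. \<forall>b\<in>X \<times> {0}. c (\<psi> a) = c (\<psi> b)))"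
proof -
  have "finite X"
    using assms(1) by (simp add: ramsey_set_def)
  obtain N \<Phi> where \<Phi>: "finite \<Phi>" "\<And>\<phi>. \<phi> \<in> \<Phi> \<Longrightarrow> isometric_embedding X N \<phi>"
    "\<And>c. (\<And>v. c v < K) \<Longrightarrow> \<exists>\<phi>\<in>\<Phi>. \<forall>x\<in>X. \<forall>y\<in>X. c (\<phi> x) = c (\<phi> y)"
    using finitely_many_copies_suffice[OF assms, of K] by blast
  have "\<exists>ext. \<forall>\<phi>\<in>\<Phi>. isometric_embedding ((affine hull X) \<times> (UNIV :: real set)) (Suc N) (ext \<phi>) \<and>
      (\<forall>x\<in>X. ext \<phi> (x, 0) = case_nat 0 (\<phi> x))"
  proof (intro bchoice ballI)
    fix \<phi> assume "\<phi> \<in> \<Phi>"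
    then show "\<exists>\<psi>. isometric_embedding ((affine hull X) \<times> (UNIV :: real set)) (Suc N) \<psi> \<and>
        (\<forall>x\<in>X. \<psi> (x, 0) = case_nat 0 (\<phi> x))"
      by (intro isometric_embedding_extend \<open>finite X\<close> \<Phi>(2))
  qed
  then obtain ext where
    ext: "\<And>\<phi>. \<phi> \<in> \<Phi> \<Longrightarrow> isometric_embedding ((affine hull X) \<times> (UNIV :: real set)) (Suc N) (ext \<phi>)"
      "\<And>\<phi> x. \<phi> \<in> \<Phi> \<Longrightarrow> x \<in> X \<Longrightarrow> ext \<phi> (x, 0) = case_nat 0 (\<phi> x)"
    by blast
  show ?thesis
  proof (intro exI[of _ "Suc N"] exI[of _ "ext ` \<Phi>"] conjI allI impI)
    fix c :: "(nat \<Rightarrow> real) \<Rightarrow> nat"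
    assume "\<forall>v. c v < K"
    then obtain \<phi> where \<phi>: "\<phi> \<in> \<Phi>"
      "\<And>x y. x \<in> X \<Longrightarrow> y \<in> X \<Longrightarrow> c (case_nat 0 (\<phi> x)) = c (case_nat 0 (\<phi> y))"
      using \<Phi>(3)[of "\<lambda>v. c (case_nat 0 v)"] by blast
    have "c (ext \<phi> a) = c (ext \<phi> b)" if "a \<in> X \<times> {0}" "b \<in> X \<times> {0}" for a b
      using that ext(2)[OF \<phi>(1)] \<phi>(2)[of "fst a" "fst b"] by (cases a; cases b) simp
    then show "\<exists>\<psi>\<in>ext ` \<Phi>. \<forall>a\<in>X \<times> {0}. \<forall>b\<in>X \<times> {0}. c (\<psi> a) = c (\<psi> b)"
      using \<phi>(1) by blast
  qed (use \<Phi>(1) ext(1) in auto)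
qed

theorem theorem1p1:
  fixes X :: "'a::euclidean_space set" and z :: 'a
  assumes "finite X"
    and "ramsey_set X"
    and "z \<notin> affine hull X"
  shows "ramsey_set (X \<union> {z})"
proof (cases "X = {}")
  case True
  have "monochromatic_copy {z} 0 c (\<lambda>_ _. 0)" for c
    by (simp add: monochromatic_copy_def topspace_Euclidean_space euclidean_dist_def)
  with True show ?thesis
    unfolding ramsey_set_def by auto
next
  case False
  then obtain x0 where "x0 \<in> X" by auto
  obtain p where p: "p \<in> affine hull X"
    and pythagoras: "\<And>x. x \<in> X \<Longrightarrow> (dist z x)\<^sup>2 = (dist p x)\<^sup>2 + (dist z p)\<^sup>2"
    using affine_hull_pythagoras[OF False, of z] hull_inc[of _ X affine] by blast
  have "dist z p > 0"
    using p assms(3) by auto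
  obtain m :: nat where m: "(dist p x0)\<^sup>2 / (dist z p)\<^sup>2 < m"
    using reals_Archimedean2 by blast
  then have "m > 0"
    using le_less_trans[of 0 "(dist p x0)\<^sup>2 / (dist z p)\<^sup>2" "real m"] by simp
  have height: "(dist p x0)\<^sup>2 / m \<le> (dist z p)\<^sup>2"
    using m \<open>m > 0\<close> \<open>dist z p > 0\<close> by (simp add: field_simps)
  (* A straight path in m equal steps from p to x0 contributes |p - x0|^2 / m to the squared distance.
     To reach the prescribed height exactly, the path starts at height u and drops to 0 in its first
     step: the height u counts once for the start and once for the drop. *)
  define u where "u = sqrt (((dist z p)\<^sup>2 - (dist p x0)\<^sup>2 / m) / 2)"
  have u: "2 * u\<^sup>2 + (dist p x0)\<^sup>2 / m = (dist z p)\<^sup>2"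
    using height by (simp add: u_def diff_divide_distrib)
  define q :: "nat \<Rightarrow> 'a \<times> real" where
    "q r = (p + (r / m) *\<^sub>R (x0 - p), if r = 0 then u else 0)" for r
  have q_hull: "q r \<in> (affine hull X) \<times> UNIV" for r
  proof -
    have "(1 - r / m) *\<^sub>R p + (r / m) *\<^sub>R x0 \<in> affine hull X"
      using p \<open>x0 \<in> X\<close> by (intro mem_affine affine_affine_hull) (auto simp: hull_inc)
    then show ?thesis
      by (simp add: q_def algebra_simps)
  qed
  have q_end: "q m = (x0, 0)"
    using \<open>m > 0\<close> by (simp add: q_def)
  have q_steps: "(\<Sum>r<m. (dist (q r) (q (Suc r)))\<^sup>2) = u\<^sup>2 + (dist p x0)\<^sup>2 / m"
  proof -
    have step: "(dist (q r) (q (Suc r)))\<^sup>2 = (dist p x0)\<^sup>2 / m\<^sup>2 + (if r = 0 then u\<^sup>2 else 0)" for r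
    proof -
      have "(p + (r / m) *\<^sub>R (x0 - p)) - (p + (Suc r / m) *\<^sub>R (x0 - p)) = (1 / m) *\<^sub>R (p - x0)"
        by (simp add: add_divide_distrib algebra_simps)
      then have "(dist (p + (r / m) *\<^sub>R (x0 - p)) (p + (Suc r / m) *\<^sub>R (x0 - p)))\<^sup>2 = (dist p x0)\<^sup>2 / m\<^sup>2"
        unfolding dist_norm by (simp add: power_divide)
      then show ?thesis
        by (simp add: q_def dist_Pair_Pair dist_real_def)
    qed
    have "(\<Sum>r<m. (dist (q r) (q (Suc r)))\<^sup>2) = m * ((dist p x0)\<^sup>2 / m\<^sup>2) + u\<^sup>2"
      using \<open>m > 0\<close> by (simp add: step sum.distrib)
    also have "m * ((dist p x0)\<^sup>2 / m\<^sup>2) = (dist p x0)\<^sup>2 / m"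
      using \<open>m > 0\<close> by (simp add: power2_eq_square)
    finally show ?thesis by simp
  qed
  show ?thesis
    unfolding ramsey_set_def
  proof (intro conjI allI impI)
    show "finite (X \<union> {z})"
      using assms(1) by simp
    fix k :: nat assume "1 \<le> k"
    have M: "finite (X \<times> {0::real})" "X \<times> {0} \<subseteq> (affine hull X) \<times> UNIV"
      "q ` {..m} \<subseteq> (affine hull X) \<times> UNIV" "q m \<in> X \<times> {0}"
      using assms(1) image_subsetI[of "{..m}" q, OF q_hull] q_end \<open>x0 \<in> X\<close> hull_subset[of X affine]
      by auto
    obtain D where D: "\<forall>c. (\<forall>v. c v < k) \<longrightarrow>
      (\<exists>\<theta> w. isometric_embedding (X \<times> {0}) D \<theta> \<and> w \<in> topspace (Euclidean_space D) \<and>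
        (\<forall>a\<in>X \<times> {0}. c (\<theta> a) = c w \<and>
          (euclidean_dist D (\<theta> a) w)\<^sup>2 = (dist a (q 0))\<^sup>2 + (\<Sum>r<m. (dist (q r) (q (Suc r)))\<^sup>2)))"
      using path_forcing[OF M ramsey_set_forces_extended_copies[OF assms(2) False], of k] by (rule exE)
    show "\<exists>N. \<forall>c\<in>topspace (Euclidean_space N) \<rightarrow> {..<k}. \<exists>\<phi>. monochromatic_copy (X \<union> {z}) N c \<phi>"
    proof (intro exI[of _ D] ballI)
      fix c :: "(nat \<Rightarrow> real) \<Rightarrow> nat"
      assume c: "c \<in> topspace (Euclidean_space D) \<rightarrow> {..<k}"
      (* Values of c outside the carrier are arbitrary, hence replaced by a legal colour. *)
      define c' where "c' v = (if v \<in> topspace (Euclidean_space D) then c v else 0)" for v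
      have "c' v < k" for v
        using c \<open>1 \<le> k\<close> by (auto simp: c'_def)
      then obtain \<theta> w where \<theta>: "isometric_embedding (X \<times> {0::real}) D \<theta>"
        and w: "w \<in> topspace (Euclidean_space D)"
        and apex: "\<And>a. a \<in> X \<times> {0} \<Longrightarrow> c' (\<theta> a) = c' w"
          "\<And>a. a \<in> X \<times> {0} \<Longrightarrow> (euclidean_dist D (\<theta> a) w)\<^sup>2
             = (dist a (q 0))\<^sup>2 + (\<Sum>r<m. (dist (q r) (q (Suc r)))\<^sup>2)"
        using D[rule_format, of c'] by blast
      have \<theta>_carrier: "\<theta> (x, 0) \<in> topspace (Euclidean_space D)" if "x \<in> X" for x
        using \<theta> that by (auto simp: isometric_embedding_def)
      have \<theta>_dist: "euclidean_dist D (\<theta> (x, 0)) (\<theta> (y, 0)) = dist x y" if "x \<in> X" "y \<in> X" for x y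
        using \<theta> that by (simp add: isometric_embedding_def dist_Pair_Pair)
      have colour: "c (\<theta> (x, 0)) = c w" if "x \<in> X" for x
        using apex(1)[of "(x, 0)"] that \<theta>_carrier[OF that] w by (simp add: c'_def)
      have apex_dist: "euclidean_dist D (\<theta> (x, 0)) w = dist x z" if "x \<in> X" for x
      proof -
        have "(euclidean_dist D (\<theta> (x, 0)) w)\<^sup>2 = (dist p x)\<^sup>2 + u\<^sup>2 + (u\<^sup>2 + (dist p x0)\<^sup>2 / m)"
          using apex(2)[of "(x, 0)", unfolded q_steps] that
          by (simp add: q_def dist_Pair_Pair dist_real_def dist_commute)
        also have "\<dots> = (dist x z)\<^sup>2"
          using u pythagoras[OF that] by (simp add: dist_commute)
        finally show ?thesis
          by (simp add: euclidean_dist_def)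
      qed
      have dist_sym: "euclidean_dist D v v' = euclidean_dist D v' v" for v v'
        by (simp add: euclidean_dist_def L2_set_def power2_commute)
      then have apex_dist': "euclidean_dist D w (\<theta> (x, 0)) = dist z x" if "x \<in> X" for x
        using apex_dist[OF that] by (simp add: dist_commute)
      have dist_self: "euclidean_dist D v v = 0" for v
        by (simp add: euclidean_dist_def L2_set_def)
      have "z \<notin> X"
        using assms(3) hull_inc[of z X affine] by blast
      define \<phi> where "\<phi> x = (if x = z then w else \<theta> (x, 0))" for x
      have \<phi>: "\<phi> z = w" "\<And>x. x \<in> X \<Longrightarrow> \<phi> x = \<theta> (x, 0)"
        using \<open>z \<notin> X\<close> by (auto simp: \<phi>_def)
      have "monochromatic_copy (X \<union> {z}) D c \<phi>"
        unfolding monochromatic_copy_def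
      proof (intro conjI ballI funcsetI)
        fix x assume x: "x \<in> X \<union> {z}"
        then show "\<phi> x \<in> topspace (Euclidean_space D)"
          using w \<theta>_carrier by (auto simp: \<phi>)
        fix y assume y: "y \<in> X \<union> {z}"
        show "euclidean_dist D (\<phi> x) (\<phi> y) = dist x y"
          using x y by (auto simp: \<phi> \<theta>_dist apex_dist apex_dist' dist_self)
        show "c (\<phi> x) = c (\<phi> y)"
          using x y by (auto simp: \<phi> colour)
      qed
      then show "\<exists>\<phi>. monochromatic_copy (X \<union> {z}) D c \<phi>"
        by (intro exI[of _ \<phi>])
    qed
  qed
qed

end
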